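(* Let $PD$ be the propositional language built from propositional variables $P_0,P_1,P_2,\ldots$ (distinct) with $\neg$ and $\to$, and let $\mathcal{T}\subset PD$ be the set of all tautologies under the standard two-valued valuation. For $A\in PD$ let $h(A)$ be the formula obtained by erasing every occurrence of $\neg$ in $A$. Let $R_1=\{X\to(Y\to X)\mid X,Y\in PD\}$, $R_2=\{(X\to(Y\to Z))\to((X\to Y)\to(X\to Z))\mid X,Y,Z\in PD\}$, $R_3=\{(\neg X\to\neg Y)\to(Y\to X)\mid X,Y\in PD\}$, $R_3'=\{A\in R_3\mid h(A)\in\mathcal{T}\}$, and $R^1=R_1\cup R_2\cup R_3'$. Let $R^3(PD)=\{(X\to Y,X,Y)\mid X,Y\in PD\}$ (Modus Ponens). For each integer $n\geq 1$ let $J_n=(\neg P_0\to\neg P_n)\to(P_n\to P_0)$ and let $C_n$ be the operator generated by the rules of inference $\{R^1\cup\{J_n\},R^3(PD)\}$, i.e. $\{R^1\cup\{J_n\},R^3(PD)\}\Rightarrow C_n$. Then each $C_n$ is a finite consequence operator on $\mathcal{P}(PD)$, but $\bigwedge\{C_n\mid n\geq 1\}$ is a general consequence operator on $\mathcal{P}(PD)$ that is not a finite consequence operator.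
   Context: $\mathcal{P}(PD)$ is the power set of $PD$ and $\mathcal{F}(X)$ is the set of all finite subsets of $X$. A general consequence operator on $\mathcal{P}(PD)$ is a map $C\colon\mathcal{P}(PD)\to\mathcal{P}(PD)$ such that for all $X,Y\subset PD$: (1) $X\subset C(X)=C(C(X))$; (2) if $X\subset Y$, then $C(X)\subset C(Y)$. It is a finite consequence operator if, in addition, $C(X)=\bigcup\{C(F)\mid F\in\mathcal{F}(X)\}$ for all $X\subset PD$. For a nonempty set $\mathcal{H}$ of general consequence operators, $(\bigwedge\mathcal{H})(X)=\bigcap\{C(X)\mid C\in\mathcal{H}\}$ for $X\subset PD$; this is its infimum under the pointwise inclusion order. For a set $RI$ of relations on $PD$ (each $n$-ary for some $n\geq 1$), a deduction from $X\subset PD$ is a finite sequence $b_1,\ldots,b_m$ ($m\geq 1$) of members of $PD$ such that for each $i$ at least one of the following holds: $b_i\in X$; $b_i$ is a member of some unary relation in $RI$; there are $j\geq 1$, a $(j+1)$-ary relation $R\in RI$ and $(a_1,\ldots,a_j,a_{j+1})\in R$ with $a_1,\ldots,a_j\in\{b_1,\ldots,b_{i-1}\}$ and $b_i=a_{j+1}$. One writes $X\vdash x$ if there is such a deduction with last term $x$. The notation $RI\Rightarrow C$ means that $C(X)=\{x\in PD\mid X\vdash x\}$ for all $X\subset PD$. A set of formulas such as $R^1\cup\{J_n\}$ is regarded as a unary relation on $PD$. *)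

theory Defs
  imports Main
begin

text \<open>The formulas; the language PD of the paper is the whole type, so that
  \<open>form set\<close> is its power set.\<close>

datatype form =
    Var nat
  | Neg form  ("\<^bold>\<not> _" [60] 60)
  | Imp form form  (infixr "\<^bold>\<rightarrow>" 55)

primrec eval :: "(nat \<Rightarrow> bool) \<Rightarrow> form \<Rightarrow> bool" where
  "eval v (Var n) = v n"
| "eval v (\<^bold>\<not> A) = (\<not> eval v A)"
| "eval v (A \<^bold>\<rightarrow> B) = (eval v A \<longrightarrow> eval v B)"

definition tautologies :: "form set" where
  "tautologies = {A. \<forall>v. eval v A}"

primrec erase_neg :: "form \<Rightarrow> form" where
  "erase_neg (Var n) = Var n"
| "erase_neg (\<^bold>\<not> A) = erase_neg A"
| "erase_neg (A \<^bold>\<rightarrow> B) = erase_neg A \<^bold>\<rightarrow> erase_neg B"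


definition general_consequence_operator :: "('a set \<Rightarrow> 'a set) \<Rightarrow> bool" where
  "general_consequence_operator C \<longleftrightarrow>
     (\<forall>X. X \<subseteq> C X \<and> C X = C (C X)) \<and>
     (\<forall>X Y. X \<subseteq> Y \<longrightarrow> C X \<subseteq> C Y)"

definition finite_consequence_operator :: "('a set \<Rightarrow> 'a set) \<Rightarrow> bool" where
  "finite_consequence_operator C \<longleftrightarrow>
     general_consequence_operator C \<and> (\<forall>X. C X = (\<Union>F\<in>Fpow X. C F))"

definition op_meet :: "('a set \<Rightarrow> 'a set) set \<Rightarrow> 'a set \<Rightarrow> 'a set" where
  "op_meet H X = (\<Inter>C\<in>H. C X)"

lemma op_meet_eq_Inf: "op_meet H = Inf H"
  by (rule ext) (simp add: op_meet_def)


text \<open>An \<open>n\<close>-ary relation is a set of lists of length \<open>n\<close>. This allows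
  relations of different arities to be members of one set \<open>RI\<close>.\<close>

definition nary :: "nat \<Rightarrow> 'a list set \<Rightarrow> bool" where
  "nary n R \<longleftrightarrow> (\<forall>t\<in>R. length t = n)"

definition unary_rel :: "'a set \<Rightarrow> 'a list set" where
  "unary_rel A = {[x] | x. x \<in> A}"

definition deduction :: "'a list set set \<Rightarrow> 'a set \<Rightarrow> 'a list \<Rightarrow> bool" where
  "deduction RI X bs \<longleftrightarrow> bs \<noteq> [] \<and>
     (\<forall>i < length bs.
        bs ! i \<in> X \<or>
        (\<exists>R\<in>RI. nary 1 R \<and> [bs ! i] \<in> R) \<or>
        (\<exists>j\<ge>1. \<exists>R\<in>RI. nary (j + 1) R \<and>
           (\<exists>as a. length as = j \<and> as @ [a] \<in> R \<and>
              set as \<subseteq> set (take i bs) \<and> bs ! i = a)))"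

definition derives :: "'a list set set \<Rightarrow> 'a set \<Rightarrow> 'a \<Rightarrow> bool" where
  "derives RI X x \<longleftrightarrow> (\<exists>bs. deduction RI X bs \<and> last bs = x)"

definition generates :: "'a list set set \<Rightarrow> ('a set \<Rightarrow> 'a set) \<Rightarrow> bool" where
  "generates RI C \<longleftrightarrow> (\<forall>X. C X = {x. derives RI X x})"


definition ax1 :: "form set" where
  "ax1 = {X \<^bold>\<rightarrow> (Y \<^bold>\<rightarrow> X) | X Y. True}"

definition ax2 :: "form set" where
  "ax2 = {(X \<^bold>\<rightarrow> (Y \<^bold>\<rightarrow> Z)) \<^bold>\<rightarrow> ((X \<^bold>\<rightarrow> Y) \<^bold>\<rightarrow> (X \<^bold>\<rightarrow> Z)) | X Y Z. True}"

definition ax3 :: "form set" where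
  "ax3 = {(\<^bold>\<not> X \<^bold>\<rightarrow> \<^bold>\<not> Y) \<^bold>\<rightarrow> (Y \<^bold>\<rightarrow> X) | X Y. True}"

definition ax3_restricted :: "form set" where
  "ax3_restricted = {A \<in> ax3. erase_neg A \<in> tautologies}"

definition base_axioms :: "form set" where
  "base_axioms = ax1 \<union> ax2 \<union> ax3_restricted"

definition modus_ponens :: "form list set" where
  "modus_ponens = {[X \<^bold>\<rightarrow> Y, X, Y] | X Y. True}"

definition J :: "nat \<Rightarrow> form" where
  "J n = (\<^bold>\<not> Var 0 \<^bold>\<rightarrow> \<^bold>\<not> Var n) \<^bold>\<rightarrow> (Var n \<^bold>\<rightarrow> Var 0)"

end

(* Call a formula v-good if it is true under v after erasing every negation. Modus Ponens
   preserves v-goodness and the base axioms are v-good for every v, whereas J n is v-good unless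
   v makes P_n true and P_0 false. Let X = {J n -> P_0 | n >= 1}. Every C n derives P_0 from X.
   A finite subset F of X mentions J n only for n in a finite set S; for m >= 1 outside S, the
   valuation that makes exactly the variables P_n with n in S true makes J m and F good, but not
   P_0. So C m does not derive P_0 from F. *)

theory Submission
  imports Defs
begin

section \<open>Deductions\<close>

(* With as = [] this is also the clause for unary relations. *)
definition justified :: "'a list set set \<Rightarrow> 'a set \<Rightarrow> 'a set \<Rightarrow> 'a \<Rightarrow> bool" where
  "justified RI X S x \<longleftrightarrow> x \<in> X \<or>
     (\<exists>R\<in>RI. \<exists>as. nary (length as + 1) R \<and> as @ [x] \<in> R \<and> set as \<subseteq> S)"

text \<open>Unlike a deduction, such a list may be empty. This gives the concatenation of deductions
  a base case.\<close>

definition justified_list :: "'a list set set \<Rightarrow> 'a set \<Rightarrow> 'a list \<Rightarrow> bool" where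
  "justified_list RI X bs \<longleftrightarrow>
     (\<forall>i < length bs. justified RI X (set (take i bs)) (bs ! i))"

lemma justified_mono:
  "justified RI X S x \<Longrightarrow> X \<subseteq> Y \<Longrightarrow> S \<subseteq> T \<Longrightarrow> justified RI Y T x"
  unfolding justified_def by blast

text \<open>The unary clause of \<open>deduction\<close> is the case \<open>as = []\<close> of the
  rule clause in \<open>justified\<close>, and the clause with \<open>j \<ge> 1\<close> is the case
  of nonempty \<open>as\<close>.\<close>

lemma deduction_iff: "deduction RI X bs \<longleftrightarrow> bs \<noteq> [] \<and> justified_list RI X bs"
proof -
  have "justified RI X S x \<longleftrightarrow>
      x \<in> X \<or> (\<exists>R\<in>RI. nary 1 R \<and> [x] \<in> R) \<or>
      (\<exists>j\<ge>1. \<exists>R\<in>RI. nary (j + 1) R \<and>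
         (\<exists>as a. length as = j \<and> as @ [a] \<in> R \<and> set as \<subseteq> S \<and> x = a))"
    (is "_ \<longleftrightarrow> ?rhs") for S and x :: 'a
  proof
    assume "justified RI X S x"
    then consider "x \<in> X"
      | R as where "R \<in> RI" "nary (length as + 1) R" "as @ [x] \<in> R" "set as \<subseteq> S"
      unfolding justified_def by blast
    then show ?rhs
    proof cases
      case 2
      show ?thesis
      proof (cases as)
        case Nil
        with 2 show ?thesis by auto
      next
        case Cons
        then have "length as \<ge> 1" by simp
        with 2 show ?thesis by blast
      qed
    qed blast
  next
    assume ?rhs
    then consider "x \<in> X"
      | R where "R \<in> RI" "nary (length [] + 1) R" "[] @ [x] \<in> R" "set [] \<subseteq> S"
      | R as where "R \<in> RI" "nary (length as + 1) R" "as @ [x] \<in> R" "set as \<subseteq> S"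
      by auto
    then show "justified RI X S x"
      unfolding justified_def by cases blast+
  qed
  then show ?thesis
    unfolding deduction_def justified_list_def by simp
qed

lemma justified_list_Nil: "justified_list RI X []"
  by (simp add: justified_list_def)

text \<open>Behind \<open>bs\<close>, each entry of \<open>cs\<close> only gains predecessors, and
  justification is monotone in these.\<close>

lemma justified_list_append:
  assumes "justified_list RI X bs" and "justified_list RI X cs"
  shows "justified_list RI X (bs @ cs)"
  unfolding justified_list_def
proof (intro allI impI)
  fix i assume i: "i < length (bs @ cs)"
  show "justified RI X (set (take i (bs @ cs))) ((bs @ cs) ! i)"
  proof (cases "i < length bs")
    case True
    then show ?thesis
      using assms(1) by (simp add: justified_list_def nth_append)
  next
    case False
    then have "justified RI X (set (take (i - length bs) cs)) (cs ! (i - length bs))"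
      using assms(2) i by (simp add: justified_list_def)
    then show ?thesis
      using False by (auto simp: nth_append elim: justified_mono)
  qed
qed

lemma justified_list_snoc:
  assumes "justified_list RI X bs" and "justified RI X (set bs) x"
  shows "justified_list RI X (bs @ [x])"
  using assms by (auto simp: justified_list_def nth_append less_Suc_eq)

text \<open>Concatenating deductions of all premises of the rule gives one list that contains every
  premise; appending \<open>x\<close> to it yields a deduction of \<open>x\<close>.\<close>

lemma derives_rule:
  assumes "justified RI X {y. derives RI X y} x"
  shows "derives RI X x"
proof -
  have "\<exists>bs. justified_list RI X bs \<and> set as \<subseteq> set bs"
    if "set as \<subseteq> {y. derives RI X y}" for as
    using that
  proof (induction as)
    case Nil
    show ?case using justified_list_Nil by auto
  next
    case (Cons a as)
    then obtain bs where bs: "justified_list RI X bs" "set as \<subseteq> set bs"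
      by auto
    from Cons.prems obtain cs where cs: "cs \<noteq> []" "justified_list RI X cs" "last cs = a"
      by (auto simp: derives_def deduction_iff)
    have "set (a # as) \<subseteq> set (bs @ cs)"
      using bs cs by auto
    then show ?case
      using justified_list_append[OF bs(1) cs(2)] by blast
  qed
  \<comment> \<open>If \<open>x \<in> X\<close>, the empty list serves as \<open>bs\<close>;
    otherwise the claim above is applied to the premises of the rule.\<close>
  with assms obtain bs where "justified_list RI X bs" "justified RI X (set bs) x"
    unfolding justified_def by (metis empty_set empty_subsetI justified_list_Nil)
  then have "deduction RI X (bs @ [x])"
    by (simp add: deduction_iff justified_list_snoc)
  then show ?thesis
    unfolding derives_def by fastforce
qed

lemma derives_premise: "x \<in> X \<Longrightarrow> derives RI X x"
  by (rule derives_rule) (simp add: justified_def)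

text \<open>Together with \<open>derives_rule\<close> this describes the derivable elements as the
  least set closed under single steps, so later arguments can mostly avoid lists. It is
  course-of-values induction on the position in a deduction.\<close>

lemma derives_induct [consumes 1, case_names step]:
  assumes "derives RI X x"
    and step: "\<And>y. justified RI X {z. P z} y \<Longrightarrow> P y"
  shows "P x"
proof -
  from assms(1) obtain bs where bs: "bs \<noteq> []" "justified_list RI X bs" "last bs = x"
    by (auto simp: derives_def deduction_iff)
  have "P (bs ! i)" if "i < length bs" for i
    using that
  proof (induction i rule: less_induct)
    case (less i)
    then have "set (take i bs) \<subseteq> {z. P z}"
      by (auto simp: in_set_conv_nth)
    moreover have "justified RI X (set (take i bs)) (bs ! i)"
      using bs(2) less.prems by (simp add: justified_list_def)
    ultimately have "justified RI X {z. P z} (bs ! i)"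
      by (rule justified_mono[OF _ subset_refl, rotated])
    then show ?case
      by (rule step)
  qed
  with bs show ?thesis
    by (auto simp: last_conv_nth)
qed

lemma derives_mono:
  assumes "derives RI X x" and "X \<subseteq> Y"
  shows "derives RI Y x"
  using assms(1)
proof (induction rule: derives_induct)
  case (step y)
  then show ?case
    using assms(2) by (blast intro: derives_rule justified_mono)
qed

lemma derives_cut:
  assumes "derives RI {y. derives RI X y} x"
  shows "derives RI X x"
  using assms
proof (induction rule: derives_induct)
  case (step y)
  \<comment> \<open>A premise used here is itself derivable from \<open>X\<close>; a rule
    application has all its premises derivable by the induction hypothesis.\<close>
  then have "derives RI X y \<or> justified RI X {z. derives RI X z} y"
    unfolding justified_def by blast
  then show ?case
    using derives_rule[of RI X y] by blast
qed

text \<open>A deduction has finitely many entries, so it can cite only the finitely many members of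
  \<open>X\<close> that occur in it.\<close>

lemma derives_finite_premises:
  assumes "derives RI X x"
  obtains F where "F \<in> Fpow X" "derives RI F x"
proof -
  from assms obtain bs where bs: "bs \<noteq> []" "justified_list RI X bs" "last bs = x"
    by (auto simp: derives_def deduction_iff)
  have "justified_list RI (set bs \<inter> X) bs"
    using bs(2) unfolding justified_list_def justified_def by (metis IntI nth_mem)
  then have "derives RI (set bs \<inter> X) x"
    using bs by (auto simp: derives_def deduction_iff)
  moreover have "set bs \<inter> X \<in> Fpow X"
    by (simp add: Fpow_def)
  ultimately show ?thesis
    using that by blast
qed

section \<open>Consequence operators\<close>

lemma generates_finite_consequence_operator:
  assumes "generates RI C"
  shows "finite_consequence_operator C"
proof -
  have C: "C X = {x. derives RI X x}" for X
    using assms by (simp add: generates_def)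
  have "X \<subseteq> C X" "X \<subseteq> Y \<Longrightarrow> C X \<subseteq> C Y" "C (C X) \<subseteq> C X" for X Y
    unfolding C by (auto intro: derives_premise derives_mono derives_cut)
  then have general: "general_consequence_operator C"
    unfolding general_consequence_operator_def by (meson subset_antisym)
  have "C X = (\<Union>F\<in>Fpow X. C F)" for X
  proof
    show "C X \<subseteq> (\<Union>F\<in>Fpow X. C F)"
      unfolding C by (auto elim: derives_finite_premises)
    show "(\<Union>F\<in>Fpow X. C F) \<subseteq> C X"
      unfolding C by (auto simp: Fpow_def intro: derives_mono)
  qed
  with general show ?thesis
    unfolding finite_consequence_operator_def by blast
qed

text \<open>The main point is idempotence: the meet at \<open>X\<close> lies inside
  \<open>C X\<close> for each \<open>C \<in> H\<close>, so applying \<open>C\<close> to it stays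
  inside \<open>C (C X) = C X\<close>.\<close>

lemma op_meet_general_consequence_operator:
  assumes "\<And>C. C \<in> H \<Longrightarrow> general_consequence_operator C"
  shows "general_consequence_operator (op_meet H)"
proof -
  have mono: "C X \<subseteq> C Y" if "C \<in> H" "X \<subseteq> Y" for C X Y
    using assms[OF that(1)] that(2) unfolding general_consequence_operator_def by blast
  have ext: "X \<subseteq> C X" and idem: "C X = C (C X)" if "C \<in> H" for C X
    using assms[OF that] unfolding general_consequence_operator_def by blast+
  have meet_ext: "X \<subseteq> op_meet H X" for X
    unfolding op_meet_def by (rule INF_greatest) (rule ext)
  have meet_mono: "op_meet H X \<subseteq> op_meet H Y" if "X \<subseteq> Y" for X Y
    unfolding op_meet_def
  proof (rule INF_superset_mono)
    show "C X \<subseteq> C Y" if "C \<in> H" for C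
      using that \<open>X \<subseteq> Y\<close> by (rule mono)
  qed (rule subset_refl)
  have "op_meet H (op_meet H X) \<subseteq> op_meet H X" for X
    unfolding op_meet_def
  proof (rule INF_superset_mono)
    fix C assume C: "C \<in> H"
    then have "C (\<Inter>D\<in>H. D X) \<subseteq> C (C X)"
      by (rule mono) (rule INF_lower[OF C])
    then show "C (\<Inter>D\<in>H. D X) \<subseteq> C X"
      by (simp only: idem[OF C, symmetric])
  qed (rule subset_refl)
  with meet_ext have meet_idem: "op_meet H X = op_meet H (op_meet H X)" for X
    by (rule subset_antisym)
  show ?thesis
    unfolding general_consequence_operator_def
    by (intro conjI allI impI) (fact meet_ext meet_idem meet_mono)+
qed

section \<open>Soundness of the erased valuation\<close>

lemma derives_unary_rel:
  assumes "a \<in> A" and "unary_rel A \<in> RI"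
  shows "derives RI X a"
proof -
  have "nary (length [] + 1) (unary_rel A)" "[] @ [a] \<in> unary_rel A"
    using assms(1) by (auto simp: nary_def unary_rel_def)
  moreover have "set [] \<subseteq> {y. derives RI X y}"
    by simp
  ultimately have "justified RI X {y. derives RI X y} a"
    unfolding justified_def using assms(2) by blast
  then show ?thesis
    by (rule derives_rule)
qed

lemma derives_modus_ponens:
  assumes "derives RI X (A \<^bold>\<rightarrow> B)" and "derives RI X A" and "modus_ponens \<in> RI"
  shows "derives RI X B"
proof -
  have "nary (length [A \<^bold>\<rightarrow> B, A] + 1) modus_ponens" "[A \<^bold>\<rightarrow> B, A] @ [B] \<in> modus_ponens"
    by (auto simp: nary_def modus_ponens_def)
  moreover have "set [A \<^bold>\<rightarrow> B, A] \<subseteq> {y. derives RI X y}"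
    using assms(1,2) by simp
  ultimately have "justified RI X {y. derives RI X y} B"
    unfolding justified_def using assms(3) by blast
  then show ?thesis
    by (rule derives_rule)
qed

text \<open>Erasure commutes with implication, so Modus Ponens stays sound after it. The only other
  ways to justify an entry are membership in \<open>A\<close> or in \<open>X\<close>.\<close>

lemma eval_erase_neg_derives:
  assumes "derives {unary_rel A, modus_ponens} X x"
    and "\<And>a. a \<in> A \<union> X \<Longrightarrow> eval v (erase_neg a)"
  shows "eval v (erase_neg x)"
  using assms(1)
proof (induction rule: derives_induct)
  case (step y)
  then consider "y \<in> A \<union> X"
    | B where "eval v (erase_neg (B \<^bold>\<rightarrow> y))" "eval v (erase_neg B)"
    by (auto simp: justified_def unary_rel_def modus_ponens_def append_eq_Cons_conv)
  then show ?case
    using assms(2) by cases auto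
qed

text \<open>Erasure maps instances of \<open>ax1\<close> and \<open>ax2\<close> to instances of the
  same schemes; for \<open>ax3_restricted\<close> the claim is built into the definition.\<close>

lemma eval_erase_neg_base_axioms: "A \<in> base_axioms \<Longrightarrow> eval v (erase_neg A)"
  by (auto simp: base_axioms_def ax1_def ax2_def ax3_restricted_def tautologies_def)

text \<open>The erased formula is \<open>(P_0 -> P_n) -> (P_n -> P_0)\<close>, and its antecedent
  holds whenever \<open>P_n\<close> does.\<close>

lemma eval_erase_neg_J: "eval v (erase_neg (J n)) \<longleftrightarrow> (v n \<longrightarrow> v 0)"
  by (auto simp: J_def)

lemma derives_J_escape:
  "derives {unary_rel (base_axioms \<union> {J n}), modus_ponens} {J k \<^bold>\<rightarrow> Var 0 | k. k \<ge> 1} (Var 0)"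
  if "n \<ge> 1"
proof (rule derives_modus_ponens)
  show "derives {unary_rel (base_axioms \<union> {J n}), modus_ponens}
      {J k \<^bold>\<rightarrow> Var 0 | k. k \<ge> 1} (J n \<^bold>\<rightarrow> Var 0)"
    by (rule derives_premise) (use that in blast)
  show "derives {unary_rel (base_axioms \<union> {J n}), modus_ponens}
      {J k \<^bold>\<rightarrow> Var 0 | k. k \<ge> 1} (J n)"
    by (rule derives_unary_rel[of _ "base_axioms \<union> {J n}"]) auto
qed simp

lemma not_derives_J_escape_finite:
  assumes "F \<in> Fpow {J k \<^bold>\<rightarrow> Var 0 | k. k \<ge> 1}"
  obtains m where "m \<ge> 1"
    "\<not> derives {unary_rel (base_axioms \<union> {J m}), modus_ponens} F (Var 0)"
proof -
  have "finite F" "F \<subseteq> (\<lambda>k. J k \<^bold>\<rightarrow> Var 0) ` {1..}"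
    using assms by (auto simp: Fpow_def)
  \<comment> \<open>Choosing a finite set of indices whose image is \<open>F\<close> avoids reading
    \<open>k\<close> off a formula.\<close>
  from finite_subset_image[OF this] obtain S where S: "S \<subseteq> {1..}" "finite S" "F = (\<lambda>k. J k \<^bold>\<rightarrow> Var 0) ` S"
    by blast
  \<comment> \<open>Excluding 0 as well ensures \<open>m \<ge> 1\<close>.\<close>
  obtain m where m: "m \<notin> insert 0 S"
    using S(2) by (meson ex_new_if_finite finite.insertI infinite_UNIV_nat)
  have "\<not> derives {unary_rel (base_axioms \<union> {J m}), modus_ponens} F (Var 0)"
  proof
    assume "derives {unary_rel (base_axioms \<union> {J m}), modus_ponens} F (Var 0)"
    \<comment> \<open>Since \<open>0 \<notin> S\<close>, this valuation falsifies
      \<open>Var 0\<close> and each erased \<open>J k\<close> with \<open>k \<in> S\<close>, so the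
      premises in \<open>F\<close> hold vacuously; \<open>J m\<close> holds because
      \<open>m \<notin> S\<close>.\<close>
    then have "eval (\<lambda>k. k \<in> S) (erase_neg (Var 0))"
    proof (rule eval_erase_neg_derives)
      fix a assume "a \<in> base_axioms \<union> {J m} \<union> F"
      then consider "a \<in> base_axioms" | "a = J m"
        | k where "k \<in> S" "a = J k \<^bold>\<rightarrow> Var 0"
        using S(3) by blast
      then show "eval (\<lambda>k. k \<in> S) (erase_neg a)"
        using S(1) m by cases (auto simp: eval_erase_neg_base_axioms eval_erase_neg_J)
    qed
    then show False using S(1) by auto
  qed
  then show ?thesis using that[of m] m by simp
qed

theorem mainTheorem5:
  fixes C :: "nat \<Rightarrow> form set \<Rightarrow> form set"
  assumes "\<And>n. n \<ge> 1 \<Longrightarrow>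
    generates {unary_rel (base_axioms \<union> {J n}), modus_ponens} (C n)"
  shows "(\<forall>n\<ge>1. finite_consequence_operator (C n)) \<and>
    general_consequence_operator (op_meet {C n | n. n \<ge> 1}) \<and>
    \<not> finite_consequence_operator (op_meet {C n | n. n \<ge> 1})"
proof (intro conjI)
  show "\<forall>n\<ge>1. finite_consequence_operator (C n)"
    using assms generates_finite_consequence_operator by blast
  then show "general_consequence_operator (op_meet {C n | n. n \<ge> 1})"
    by (intro op_meet_general_consequence_operator) (auto simp: finite_consequence_operator_def)
  let ?X = "{J k \<^bold>\<rightarrow> Var 0 | k. k \<ge> 1}"
  have C: "C n Y = {x. derives {unary_rel (base_axioms \<union> {J n}), modus_ponens} Y x}"
    if "n \<ge> 1" for n Y
    using assms[OF that] by (simp add: generates_def)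
  have "Var 0 \<in> op_meet {C n | n. n \<ge> 1} ?X"
    unfolding op_meet_def using C derives_J_escape by blast
  \<comment> \<open>The index \<open>m\<close> depends on \<open>F\<close>: each finite set of
    premises is defeated by its own member of the family.\<close>
  moreover have "Var 0 \<notin> op_meet {C n | n. n \<ge> 1} F" if F: "F \<in> Fpow ?X" for F
  proof -
    obtain m where "m \<ge> 1"
      "\<not> derives {unary_rel (base_axioms \<union> {J m}), modus_ponens} F (Var 0)"
      using not_derives_J_escape_finite[OF F] .
    with C[of m F] show ?thesis
      unfolding op_meet_def by blast
  qed
  \<comment> \<open>Finiteness would place \<open>Var 0\<close> in the value of the meet at some
    finite subset of \<open>?X\<close>.\<close>
  ultimately show "\<not> finite_consequence_operator (op_meet {C n | n. n \<ge> 1})"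
    unfolding finite_consequence_operator_def by blast
qed

end
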